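(* Let $b$ be a prime, let $m,\alpha,d\in\mathbb{N}$ with $\min(\alpha,d)>1$, and let $\gamma_v\ge0$ be real weights given for all finite $v\subset\mathbb{N}$. For each dimension $s\in\mathbb{N}$, suppose $\boldsymbol{q}=(q_1,\ldots,q_{ds})=\psi_{ds}(q_* )$ is found by the Korobov algorithm with weights $\boldsymbol{\gamma}=(\gamma_v)_{v\subseteq\{1:s\}}$: $p\in\mathbb{F}_b[x]$ is irreducible with $\deg(p)=m$ and $q_*\in\mathcal{R}_m$ minimizes $B_{\alpha,d,\boldsymbol{\gamma},(1)}(\psi_{ds}(\tilde q),p)$ over $\tilde q\in\mathcal{R}_m$. Define, for $q\ge0$ and $1/\min(\alpha,d)<\lambda\le1$, $$\tilde A_{\lambda,q}:=\limsup_{s\to\infty}\left[\frac1{s^q}\sum_{\emptyset\ne v\subseteq\{1:s\}}\tilde\gamma_v^\lambda H_{\alpha,d,\lambda,(1)}^{|v|}\right].$$ Assume $\tilde A_{\lambda,q}<\infty$ for some $1/\min(\alpha,d)<\lambda\le1$ and $q\ge0$. Then the worst-case error $e(\mathcal{D}_d(P_{b^m,ds}(\boldsymbol{q},p)),\mathcal{W}_{s,\alpha,\boldsymbol{\gamma}})$ satisfies a bound which depends only polynomially on the dimension, i.e. it is at most $Cs^\beta$ for all $s$, with constants $C,\beta\ge0$ not depending on $s$.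
   Context: $\mathbb{N}$ is the set of positive integers, $\mathbb{N}_0=\mathbb{N}\cup\{0\}$, $\{a:c\}=\{a,\ldots,c\}$; $\mathbb{F}_b$ is the field with $b$ elements, identified with $\{0,\ldots,b-1\}$; $\mathcal{R}_m=\{q\in\mathbb{F}_b[x]:\deg(q)<m,\ q\ne0\}$; for $q\in\mathcal{R}_m$, $\psi_{ds}(q)=(1,q,q^2,\ldots,q^{ds-1})\pmod p$, each component reduced modulo $p$ to degree less than $m$. All $b$-adic expansions of reals in $[0,1)$ are the unique ones with infinitely many digits different from $b-1$. A non-negative integer $n=\nu_0+\nu_1b+\cdots$ is identified with $n(x)=\nu_0+\nu_1x+\cdots\in\mathbb{F}_b[x]$. Constants: $\tilde\gamma_v=\gamma_vb^{\alpha(2d-1)|v|/2}$, $H_{\alpha,d,\lambda,(1)}=-1+(1+\tilde H_{\alpha,d,\lambda,(1)})^d$, $\tilde H_{\alpha,d,\lambda,(1)}=\frac1{b^{\alpha\lambda/2}}\cdot\frac{b-1}{b^{\lambda\min(\alpha,d)}-b}$. Point sets: $v_m(\sum_{l=w}^\infty t_lx^{-l})=\sum_{l=\max(1,w)}^mt_lb^{-l}$ for Laurent series over $\mathbb{F}_b$; $P_{b^m,ds}(\boldsymbol{q},p)$ consists of $\boldsymbol{z}_n=(z_{n,1},\ldots,z_{n,ds})$, $z_{n,j}=v_m(n(x)q_j(x)/p(x))$, $0\le n<b^m$. For $y_r=\sum_{a\ge1}y_{r,a}b^{-a}\in[0,1)$, $\mathcal{D}_d(y_1,\ldots,y_d)=\sum_{a=1}^\infty\sum_{r=1}^dy_{r,a}b^{-r-(a-1)d}$,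 applied to vectors in $[0,1)^{ds}$ on each of the $s$ consecutive blocks of $d$ components; $\mathcal{D}_d(P_{b^m,ds}(\boldsymbol{q},p))$ consists of the points $\mathcal{D}_d(\boldsymbol{z}_n)\in[0,1)^s$, $0\le n<b^m$. Quality criterion: for $k\in\mathbb{N}_0$ with $b$-adic digits $\kappa_i$, $\mathrm{tr}_m(k)=\kappa_0+\kappa_1x+\cdots+\kappa_{m-1}x^{m-1}$; $D^\perp_{\boldsymbol{q},p}=\{\boldsymbol{k}\in\mathbb{N}_0^{ds}:\sum_{j=1}^{ds}\mathrm{tr}_m(k_j)q_j\equiv0\pmod p\}$. For $u\subseteq\{1:ds\}$, $w(u)$ is the set of $1\le j\le s$ with $u\cap\{(j-1)d+1:jd\}\ne\emptyset$. For $k\in\mathbb{N}$, $\tilde r_{\alpha,d,(1)}(k)=b^{-\min(\alpha,d)\mu_1(k)-\alpha/2}$, where $\mu_1(k)=a$ iff $b^{a-1}\le k<b^a$. Then $$B_{\alpha,d,\boldsymbol{\gamma},(1)}(\boldsymbol{q},p)=\sum_{\emptyset\ne u\subseteq\{1:ds\}}\tilde\gamma_{w(u)}\sum_{\substack{\boldsymbol{k}_u\in\mathbb{N}^{|u|}\\(\boldsymbol{k}_u,\boldsymbol{0})\in D^\perp_{\boldsymbol{q},p}}}\prod_{j\in u}\tilde r_{\alpha,d,(1)}(k_j),$$ where $(\boldsymbol{k}_u,\boldsymbol{0})\in\mathbb{N}_0^{ds}$ has components $0$ outside $u$. Walsh functions: with $\omega_b=e^{2\pi\mathrm{i}/b}$,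 $\mathrm{wal}_k(x)=\omega_b^{x_1\kappa_0+\cdots+x_a\kappa_{a-1}}$ for $k=\kappa_0+\cdots+\kappa_{a-1}b^{a-1}$, $x=\sum_ix_ib^{-i}$; $\mathrm{wal}_{\boldsymbol{k}}(\boldsymbol{x})=\prod_j\mathrm{wal}_{k_j}(x_j)$; $\hat f(\boldsymbol{l})=\int_{[0,1)^s}f(\boldsymbol{x})\overline{\mathrm{wal}_{\boldsymbol{l}}(\boldsymbol{x})}\,\mathrm{d}\boldsymbol{x}$. For $k=\kappa_1b^{a_1-1}+\cdots+\kappa_\nu b^{a_\nu-1}\in\mathbb{N}$ with $1\le a_\nu<\cdots<a_1$, $\kappa_i\in\{1,\ldots,b-1\}$, $\mu_\alpha(k)=a_1+\cdots+a_{\min(\nu,\alpha)}$ and $r_\alpha(k)=b^{-\mu_\alpha(k)}$; $r_\alpha(\boldsymbol{k}_v)=\prod_{j\in v}r_\alpha(k_j)$. Weighted Walsh space: $\mathcal{W}_{s,\alpha,\boldsymbol{\gamma}}$ consists of functions $f:[0,1)^s\to\mathbb{R}$ in $L_2([0,1)^s)$ with finite norm $$\|f\|_{\mathcal{W}_{s,\alpha,\boldsymbol{\gamma}}}=\max_{v\subseteq\{1:s\},\,\gamma_v\ne0}\gamma_v^{-1}\sup_{\boldsymbol{l}_v\in\mathbb{N}^{|v|}}\frac{|\hat f(\boldsymbol{l}_v,\boldsymbol{0})|}{r_\alpha(\boldsymbol{l}_v)},$$ where $(\boldsymbol{l}_v,\boldsymbol{0})\in\mathbb{N}_0^s$ has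 components $0$ outside $v$. Conventions: the Walsh series of every $f$ in the space converges absolutely to $f(\boldsymbol{x})$ at every point, and $\hat f(\boldsymbol{l}_v,\boldsymbol{0})=0$ for all $\boldsymbol{l}_v\in\mathbb{N}^{|v|}$ whenever $\gamma_v=0$. Worst-case error: for $P=\{\boldsymbol{x}_0,\ldots,\boldsymbol{x}_{N-1}\}$, $e(P,\mathcal{W}_{s,\alpha,\boldsymbol{\gamma}})=\sup\left|\frac1N\sum_{n=0}^{N-1}f(\boldsymbol{x}_n)-\int_{[0,1)^s}f(\boldsymbol{x})\,\mathrm{d}\boldsymbol{x}\right|$ over $f\in\mathcal{W}_{s,\alpha,\boldsymbol{\gamma}}$ with $\|f\|_{\mathcal{W}_{s,\alpha,\boldsymbol{\gamma}}}\le1$. *)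

theory Defs
  imports
    "HOL-Analysis.Analysis"
    "HOL-Computational_Algebra.Computational_Algebra"
    "HOL-Number_Theory.Cong"
    "Berlekamp_Zassenhaus.Finite_Field"
begin

text \<open>
  The field with \<open>b\<close> elements is \<^typ>\<open>'b::prime_card mod_ring\<close> with \<open>b = CARD('b)\<close>; its
  identification with \<open>{0, \<dots>, b - 1}\<close> is given by \<^const>\<open>of_nat\<close> and \<^const>\<open>to_int_mod_ring\<close>.
  Vectors are functions on \<^typ>\<open>nat\<close> whose components are numbered from \<open>1\<close>.
\<close>

section \<open>Digits\<close>

definition nat_digit :: "nat \<Rightarrow> nat \<Rightarrow> nat \<Rightarrow> nat"
  where "nat_digit b k i = k div b ^ i mod b"

text \<open>
  The coefficient of \<open>b\<close> to the power \<open>-a\<close> (\<open>a \<ge> 1\<close>) in the expansion of \<open>x \<in> [0,1)\<close>. The next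
  two lemmas show that this is the unique expansion with infinitely many digits other than \<open>b - 1\<close>.
\<close>

definition real_digit :: "nat \<Rightarrow> real \<Rightarrow> nat \<Rightarrow> nat"
  where "real_digit b x a = nat (\<lfloor>x * real b ^ a\<rfloor> mod int b)"

lemma real_digit_expansion:
  assumes b: "2 \<le> b" and x: "0 \<le> x" "x < 1"
  shows "real_digit b x a < b"
    and "(\<lambda>i. real (real_digit b x (Suc i)) / real b ^ Suc i) sums x"
    and "infinite {a. 1 \<le> a \<and> real_digit b x a \<noteq> b - 1}"
proof -
  define F where "F n = \<lfloor>x * real b ^ n\<rfloor>" for n
  have b0: "real b > 0" using b by simp
  have F0: "F 0 = 0" using x by (simp add: F_def floor_eq_iff)
  have dF: "int (real_digit b x a) = F a mod int b" for a
    using b by (simp add: real_digit_def F_def)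
  show "real_digit b x a < b"
    using dF[of a] b by (metis of_nat_less_iff pos_mod_bound of_nat_0_less_iff less_le_trans zero_less_numeral)
  have Fdiv: "F (Suc n) div int b = F n" for n
  proof -
    have "F n = \<lfloor>(x * real b ^ Suc n) / real_of_int (int b)\<rfloor>"
      using b0 by (simp add: F_def)
    also have "\<dots> = F (Suc n) div int b"
      unfolding F_def by (rule floor_divide_real_eq_div) simp
    finally show ?thesis by simp
  qed
  have Frec: "F (Suc n) = int b * F n + int (real_digit b x (Suc n))" for n
    unfolding dF Fdiv[of n, symmetric] by simp
  have step: "real (real_digit b x (Suc n)) / real b ^ Suc n
      = F (Suc n) / real b ^ Suc n - F n / real b ^ n" for n
  proof -
    have "real_of_int (F (Suc n)) = real b * F n + real (real_digit b x (Suc n))"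
      by (simp add: Frec)
    then show ?thesis using b0 by (simp add: field_simps)
  qed
  have psum: "(\<Sum>i<n. real (real_digit b x (Suc i)) / real b ^ Suc i) = F n / real b ^ n" for n
    by (induction n) (simp_all add: F0 step del: power_Suc)
  have inv0: "(\<lambda>n. 1 / real b ^ n) \<longlonglongrightarrow> 0"
  proof -
    have "(\<lambda>n. (1 / real b) ^ n) \<longlonglongrightarrow> 0"
      using b by (intro LIMSEQ_power_zero) simp
    then show ?thesis by (simp add: power_one_over)
  qed
  have lo: "F n / real b ^ n \<le> x" for n
    using b0 by (simp add: F_def field_simps)
  have hi: "x < F n / real b ^ n + 1 / real b ^ n" for n
  proof -
    have "x * real b ^ n < F n + 1" unfolding F_def by linarith
    then show ?thesis using b0 by (simp add: field_simps)
  qed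
  have lim: "(\<lambda>n. F n / real b ^ n) \<longlonglongrightarrow> x"
  proof (rule tendsto_sandwich[of "\<lambda>n. x - 1 / real b ^ n" _ _ "\<lambda>_. x"])
    show "\<forall>\<^sub>F n in sequentially. x - 1 / real b ^ n \<le> F n / real b ^ n"
      using hi by (intro always_eventually allI) (smt (verit))
    show "\<forall>\<^sub>F n in sequentially. F n / real b ^ n \<le> x"
      using lo by simp
    show "(\<lambda>n. x - 1 / real b ^ n) \<longlonglongrightarrow> x"
      using tendsto_diff[OF tendsto_const inv0, of x] by simp
  qed simp
  show "(\<lambda>i. real (real_digit b x (Suc i)) / real b ^ Suc i) sums x"
    unfolding sums_def psum by (rule lim)
  show "infinite {a. 1 \<le> a \<and> real_digit b x a \<noteq> b - 1}"
  proof
    assume "finite {a. 1 \<le> a \<and> real_digit b x a \<noteq> b - 1}"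
    then obtain N where N: "\<And>a. 1 \<le> a \<Longrightarrow> real_digit b x a \<noteq> b - 1 \<Longrightarrow> a \<le> N"
      by (auto simp: finite_nat_set_iff_bounded_le)
    have rec: "F (Suc n) + 1 = int b * (F n + 1)" if "N \<le> n" for n
    proof -
      have "real_digit b x (Suc n) = b - 1" using N[of "Suc n"] that by auto
      then show ?thesis using b by (simp add: Frec algebra_simps of_nat_diff)
    qed
    have const: "(F (N + k) + 1) / real b ^ (N + k) = (F N + 1) / real b ^ N" for k
    proof (induction k)
      case (Suc k)
      have "real_of_int (F (N + Suc k)) + 1 = real b * (F (N + k) + 1)"
        using arg_cong[OF rec[of "N + k"], of real_of_int] by simp
      then have "(F (N + Suc k) + 1) / real b ^ (N + Suc k) = (F (N + k) + 1) / real b ^ (N + k)"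
        using b0 by simp
      then show ?case using Suc by simp
    qed simp
    have "(\<lambda>n. F n / real b ^ n + 1 / real b ^ n) \<longlonglongrightarrow> x + 0"
      by (intro tendsto_add lim inv0)
    then have "(\<lambda>k. F (k + N) / real b ^ (k + N) + 1 / real b ^ (k + N)) \<longlonglongrightarrow> x + 0"
      by (rule LIMSEQ_ignore_initial_segment)
    moreover have "F (k + N) / real b ^ (k + N) + 1 / real b ^ (k + N) = (F N + 1) / real b ^ N" for k
      using const[of k] by (simp add: add_divide_distrib add.commute)
    ultimately have "(\<lambda>k::nat. (F N + 1) / real b ^ N) \<longlonglongrightarrow> x" by simp
    then have "(F N + 1) / real b ^ N = x"
      by (simp add: LIMSEQ_const_iff)
    with hi[of N] show False by (simp add: add_divide_distrib)
  qed
qed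

lemma real_digit_unique:
  assumes b: "2 \<le> b"
    and lt: "\<And>a. 1 \<le> a \<Longrightarrow> \<xi> a < b"
    and sums: "(\<lambda>i. real (\<xi> (Suc i)) / real b ^ Suc i) sums x"
    and inf: "infinite {a. 1 \<le> a \<and> \<xi> a \<noteq> b - 1}"
    and a: "1 \<le> a"
  shows "real_digit b x a = \<xi> a"
proof -
  have b0: "real b > 0" using b by simp
  define S where "S = rec_nat 0 (\<lambda>n s. int b * s + int (\<xi> (Suc n)))"
  have S0: "S 0 = 0" and Srec: "S (Suc n) = int b * S n + int (\<xi> (Suc n))" for n
    by (simp_all add: S_def)
  have psum: "(\<Sum>i<n. real (\<xi> (Suc i)) / real b ^ Suc i) = S n / real b ^ n" for n
  proof (induction n)
    case (Suc n)
    then show ?case using b0 by (simp add: Srec field_simps)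
  qed (simp add: S0)
  have lim: "(\<lambda>n. S n / real b ^ n) \<longlonglongrightarrow> x"
    using sums unfolding sums_def psum .
  have mono: "incseq (\<lambda>n. S n / real b ^ n)"
  proof (rule incseq_SucI)
    fix n show "S n / real b ^ n \<le> S (Suc n) / real b ^ Suc n"
      using b0 by (simp add: Srec field_simps)
  qed
  have lo: "S n / real b ^ n \<le> x" for n
    using incseq_le[OF mono lim] .
  define U where "U n = (S n + 1) / real b ^ n" for n
  have USuc: "U (Suc n) = (real b * S n + (real (\<xi> (Suc n)) + 1)) / (real b * real b ^ n)" for n
    by (simp add: U_def Srec add.assoc)
  have Ueq: "U n = (real b * S n + real b) / (real b * real b ^ n)" for n
    using b0 by (simp add: U_def field_simps)
  have Ustep: "U (Suc n) \<le> U n" for n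
  proof -
    have "real (\<xi> (Suc n)) + 1 \<le> real b" using lt[of "Suc n"] by simp
    then show ?thesis unfolding USuc Ueq[of n] using b0 by (intro divide_right_mono) simp_all
  qed
  have dec: "decseq U" using Ustep by (rule decseq_SucI)
  have inv0: "(\<lambda>n. 1 / real b ^ n) \<longlonglongrightarrow> 0"
  proof -
    have "(\<lambda>n. (1 / real b) ^ n) \<longlonglongrightarrow> 0"
      using b by (intro LIMSEQ_power_zero) simp
    then show ?thesis by (simp add: power_one_over)
  qed
  have limU: "U \<longlonglongrightarrow> x"
    using tendsto_add[OF lim inv0] unfolding U_def by (simp add: add_divide_distrib)
  have hi: "x < U n" for n
  proof -
    obtain k where k: "k > Suc n" "1 \<le> k" "\<xi> k \<noteq> b - 1"
      using inf unfolding infinite_nat_iff_unbounded by blast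
    then obtain l where l: "k = Suc l" by (cases k) auto
    have "\<xi> k < b" using lt k(2) by blast
    then have "real (\<xi> (Suc l)) + 1 < real b" using k(3) l by auto
    then have "U (Suc l) < U l"
      unfolding USuc Ueq[of l] using b0 by (intro divide_strict_right_mono) simp_all
    moreover have "U l \<le> U n" using dec k(1) l by (auto simp: decseq_def)
    moreover have "x \<le> U (Suc l)" using decseq_ge[OF dec limU] .
    ultimately show ?thesis by linarith
  qed
  have floor: "\<lfloor>x * real b ^ n\<rfloor> = S n" for n
    using lo[of n] hi[of n] b0 by (simp add: floor_eq_iff U_def field_simps)
  obtain c where c: "a = Suc c" using a by (cases a) auto
  have "\<xi> a < b" using lt a by blast
  then show ?thesis unfolding real_digit_def floor c by (simp add: Srec c)
qed

section \<open>Walsh spaces\<close>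

text \<open>The indices \<open>i\<close> with \<open>b ^ i \<le> k\<close> are those of the digits up to the leading one.\<close>

definition walsh :: "nat \<Rightarrow> nat \<Rightarrow> real \<Rightarrow> complex"
  where "walsh b k x = exp (2 * of_real pi * \<i> / of_nat b)
    ^ (\<Sum>i\<in>{i. b ^ i \<le> k}. real_digit b x (Suc i) * nat_digit b k i)"

definition walsh_vec :: "nat \<Rightarrow> nat \<Rightarrow> (nat \<Rightarrow> nat) \<Rightarrow> (nat \<Rightarrow> real) \<Rightarrow> complex"
  where "walsh_vec b s k x = (\<Prod>j\<in>{1..s}. walsh b (k j) (x j))"

definition cube :: "nat \<Rightarrow> (nat \<Rightarrow> real) measure"
  where "cube s = PiM {1..s} (\<lambda>_. restrict_space lborel {0..<1})"

definition walsh_coeff :: "nat \<Rightarrow> nat \<Rightarrow> ((nat \<Rightarrow> real) \<Rightarrow> real) \<Rightarrow> (nat \<Rightarrow> nat) \<Rightarrow> complex"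
  where "walsh_coeff b s f l = (LINT x|cube s. of_real (f x) * cnj (walsh_vec b s l x))"

text \<open>The vectors of the form \<open>(k\<^sub>v, 0)\<close> where all components of \<open>k\<^sub>v\<close> are positive.\<close>

definition indices_on :: "nat set \<Rightarrow> (nat \<Rightarrow> nat) set"
  where "indices_on v = {k. \<forall>j. 0 < k j \<longleftrightarrow> j \<in> v}"

definition mu_alpha :: "nat \<Rightarrow> nat \<Rightarrow> nat \<Rightarrow> nat"
  where "mu_alpha b \<alpha> k =
    sum_list (take \<alpha> (rev (sorted_list_of_set {a. 1 \<le> a \<and> nat_digit b k (a - 1) \<noteq> 0})))"

definition r_alpha :: "nat \<Rightarrow> nat \<Rightarrow> nat \<Rightarrow> real"
  where "r_alpha b \<alpha> k = 1 / real b ^ mu_alpha b \<alpha> k"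

definition r_alpha_vec :: "nat \<Rightarrow> nat \<Rightarrow> nat set \<Rightarrow> (nat \<Rightarrow> nat) \<Rightarrow> real"
  where "r_alpha_vec b \<alpha> v k = (\<Prod>j\<in>v. r_alpha b \<alpha> (k j))"

definition walsh_norm ::
    "nat \<Rightarrow> nat \<Rightarrow> (nat set \<Rightarrow> real) \<Rightarrow> nat \<Rightarrow> ((nat \<Rightarrow> real) \<Rightarrow> real) \<Rightarrow> ennreal"
  where "walsh_norm b \<alpha> \<gamma> s f =
    (SUP v\<in>{v. v \<subseteq> {1..s} \<and> \<gamma> v \<noteq> 0}. ennreal (1 / \<gamma> v) *
      (SUP l\<in>indices_on v. ennreal (cmod (walsh_coeff b s f l) / r_alpha_vec b \<alpha> v l)))"

text \<open>
  The last two conditions are the standing conventions on the space: \<open>f\<close> equals its absolutely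
  convergent Walsh series everywhere (\<^const>\<open>has_sum\<close> in the complex numbers is absolute
  convergence), and coefficients belonging to a zero weight vanish.
\<close>

definition walsh_space ::
    "nat \<Rightarrow> nat \<Rightarrow> (nat set \<Rightarrow> real) \<Rightarrow> nat \<Rightarrow> ((nat \<Rightarrow> real) \<Rightarrow> real) set"
  where "walsh_space b \<alpha> \<gamma> s = {f.
    f \<in> borel_measurable (cube s) \<and> integrable (cube s) (\<lambda>x. (f x)\<^sup>2) \<and>
    walsh_norm b \<alpha> \<gamma> s f < \<infinity> \<and>
    (\<forall>x\<in>space (cube s).
      ((\<lambda>l. walsh_coeff b s f l * walsh_vec b s l x) has_sum of_real (f x))
        {l. \<forall>j. j \<notin> {1..s} \<longrightarrow> l j = 0}) \<and>
    (\<forall>v. v \<subseteq> {1..s} \<and> \<gamma> v = 0 \<longrightarrow> (\<forall>l\<in>indices_on v. walsh_coeff b s f l = 0))}"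

definition worst_case_error ::
    "nat \<Rightarrow> nat \<Rightarrow> (nat set \<Rightarrow> real) \<Rightarrow> nat \<Rightarrow> nat \<Rightarrow> (nat \<Rightarrow> nat \<Rightarrow> real) \<Rightarrow> ennreal"
  where "worst_case_error b \<alpha> \<gamma> s N P =
    (SUP f\<in>{f \<in> walsh_space b \<alpha> \<gamma> s. walsh_norm b \<alpha> \<gamma> s f \<le> 1}.
      ennreal \<bar>1 / real N * (\<Sum>n<N. f (P n)) - (LINT x|cube s. f x)\<bar>)"

section \<open>Interlaced polynomial lattice point sets\<close>

definition poly_of_nat :: "nat \<Rightarrow> 'b::prime_card mod_ring poly"
  where "poly_of_nat n =
    (\<Sum>i\<in>{i. CARD('b) ^ i \<le> n}. Polynomial.monom (of_nat (nat_digit CARD('b) n i)) i)"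

text \<open>
  Laurent series in the inverse of \<open>x\<close>: the library's formal variable plays the role of the inverse
  of \<open>x\<close>, so that \<open>fls_nth L l\<close> is the coefficient of \<open>x\<close> to the power \<open>-l\<close>.
\<close>

definition laurent_of_poly :: "'b::prime_card mod_ring poly \<Rightarrow> 'b mod_ring fls"
  where "laurent_of_poly g = poly (map_poly fls_const g) fls_X_inv"

definition v_trunc :: "nat \<Rightarrow> 'b::prime_card mod_ring fls \<Rightarrow> real"
  where "v_trunc m L =
    (\<Sum>l = 1..m. real_of_int (to_int_mod_ring (fls_nth L (int l))) / real CARD('b) ^ l)"

definition lattice_point ::
    "nat \<Rightarrow> (nat \<Rightarrow> 'b::prime_card mod_ring poly) \<Rightarrow> 'b mod_ring poly \<Rightarrow> nat \<Rightarrow> nat \<Rightarrow> real"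
  where "lattice_point m q p n j =
    v_trunc m (laurent_of_poly (poly_of_nat n) * laurent_of_poly (q j) / laurent_of_poly p)"

definition interlace :: "nat \<Rightarrow> nat \<Rightarrow> (nat \<Rightarrow> real) \<Rightarrow> real"
  where "interlace b d y =
    (\<Sum>a. \<Sum>i = 1..d. real (real_digit b (y i) (Suc a)) / real b ^ (i + a * d))"

text \<open>Extensional in \<open>j\<close>, as the points of \<^const>\<open>cube\<close> are.\<close>

definition interlace_vec :: "nat \<Rightarrow> nat \<Rightarrow> nat \<Rightarrow> (nat \<Rightarrow> real) \<Rightarrow> nat \<Rightarrow> real"
  where "interlace_vec b d s z = (\<lambda>j\<in>{1..s}. interlace b d (\<lambda>i. z ((j - 1) * d + i)))"

definition interlaced_point_set ::
    "nat \<Rightarrow> nat \<Rightarrow> nat \<Rightarrow> (nat \<Rightarrow> 'b::prime_card mod_ring poly) \<Rightarrow> 'b mod_ring poly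
      \<Rightarrow> nat \<Rightarrow> nat \<Rightarrow> real"
  where "interlaced_point_set d m s q p n = interlace_vec CARD('b) d s (lattice_point m q p n)"

section \<open>Quality criterion and Korobov construction\<close>

definition tr_poly :: "nat \<Rightarrow> nat \<Rightarrow> 'b::prime_card mod_ring poly"
  where "tr_poly m k = (\<Sum>i<m. Polynomial.monom (of_nat (nat_digit CARD('b) k i)) i)"

definition dual_net ::
    "nat \<Rightarrow> nat \<Rightarrow> (nat \<Rightarrow> 'b::prime_card mod_ring poly) \<Rightarrow> 'b mod_ring poly \<Rightarrow> (nat \<Rightarrow> nat) set"
  where "dual_net m n q p =
    {k. (\<forall>j. j \<notin> {1..n} \<longrightarrow> k j = 0) \<and> [(\<Sum>j = 1..n. tr_poly m (k j) * q j) = 0] (mod p)}"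

definition block_set :: "nat \<Rightarrow> nat \<Rightarrow> nat set \<Rightarrow> nat set"
  where "block_set d s u = {j \<in> {1..s}. u \<inter> {(j - 1) * d + 1..j * d} \<noteq> {}}"

definition mu_one :: "nat \<Rightarrow> nat \<Rightarrow> nat"
  where "mu_one b k = (THE a. 1 \<le> a \<and> b ^ (a - 1) \<le> k \<and> k < b ^ a)"

definition r_tilde :: "nat \<Rightarrow> nat \<Rightarrow> nat \<Rightarrow> nat \<Rightarrow> real"
  where "r_tilde b \<alpha> d k = real b powr (- real (min \<alpha> d) * real (mu_one b k) - real \<alpha> / 2)"

definition gamma_tilde :: "nat \<Rightarrow> nat \<Rightarrow> nat \<Rightarrow> (nat set \<Rightarrow> real) \<Rightarrow> nat set \<Rightarrow> real"
  where "gamma_tilde b \<alpha> d \<gamma> v =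
    \<gamma> v * real b powr (real \<alpha> * (2 * real d - 1) * real (card v) / 2)"

text \<open>
  The inner sums have nonnegative terms and converge whenever \<open>min \<alpha> d > 1\<close>, so the real-valued
  \<^const>\<open>infsum\<close> is their value.
\<close>

definition B_crit ::
    "nat \<Rightarrow> nat \<Rightarrow> (nat set \<Rightarrow> real) \<Rightarrow> nat \<Rightarrow> nat \<Rightarrow> (nat \<Rightarrow> 'b::prime_card mod_ring poly)
      \<Rightarrow> 'b mod_ring poly \<Rightarrow> real"
  where "B_crit \<alpha> d \<gamma> m s q p =
    (\<Sum>u\<in>Pow {1..d * s} - {{}}. gamma_tilde CARD('b) \<alpha> d \<gamma> (block_set d s u) *
      (\<Sum>\<^sub>\<infinity>k\<in>indices_on u \<inter> dual_net m (d * s) q p. \<Prod>j\<in>u. r_tilde CARD('b) \<alpha> d (k j)))"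

definition R_polys :: "nat \<Rightarrow> 'b::prime_card mod_ring poly set"
  where "R_polys m = {q. q \<noteq> 0 \<and> degree q < m}"

definition psi :: "'b::prime_card mod_ring poly \<Rightarrow> 'b mod_ring poly \<Rightarrow> nat \<Rightarrow> 'b mod_ring poly"
  where "psi p q j = q ^ (j - 1) mod p"

definition korobov ::
    "nat \<Rightarrow> nat \<Rightarrow> (nat set \<Rightarrow> real) \<Rightarrow> nat \<Rightarrow> nat \<Rightarrow> 'b::prime_card mod_ring poly
      \<Rightarrow> 'b mod_ring poly \<Rightarrow> bool"
  where "korobov \<alpha> d \<gamma> m s p q \<longleftrightarrow>
    irreducible p \<and> degree p = m \<and> q \<in> R_polys m \<and>
    (\<forall>q'\<in>R_polys m. B_crit \<alpha> d \<gamma> m s (psi p q) p \<le> B_crit \<alpha> d \<gamma> m s (psi p q') p)"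

section \<open>Tractability constants\<close>

definition H_tilde :: "nat \<Rightarrow> nat \<Rightarrow> nat \<Rightarrow> real \<Rightarrow> real"
  where "H_tilde b \<alpha> d lam = 1 / real b powr (real \<alpha> * lam / 2) *
    ((real b - 1) / (real b powr (lam * real (min \<alpha> d)) - real b))"

definition H_const :: "nat \<Rightarrow> nat \<Rightarrow> nat \<Rightarrow> real \<Rightarrow> real"
  where "H_const b \<alpha> d lam = - 1 + (1 + H_tilde b \<alpha> d lam) ^ d"

definition A_tilde :: "nat \<Rightarrow> nat \<Rightarrow> nat \<Rightarrow> (nat set \<Rightarrow> real) \<Rightarrow> real \<Rightarrow> real \<Rightarrow> ereal"
  where "A_tilde b \<alpha> d \<gamma> lam q = limsup (\<lambda>s. ereal (1 / real s powr q *
    (\<Sum>v\<in>Pow {1..s} - {{}}. gamma_tilde b \<alpha> d \<gamma> v powr lam * H_const b \<alpha> d lam ^ card v)))"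

end

theory Submission
  imports Defs
begin

text \<open>
  Since \<open>m\<close> is fixed, no decay in the number of points is needed, and a bound that ignores the
  structure of the point set suffices: Walsh functions have modulus one, so for \<open>f\<close> in the unit
  ball and every \<open>x\<close> in the cube
  \[ |f(x) - \int f| \le \sum_{v \neq \emptyset} \gamma_v \Bigl(\sum_{k \ge 1} r_\alpha(k)\Bigr)^{|v|}
     \le \sum_{v \neq \emptyset} \gamma_v 2^{|v|}, \]
  because \<open>\<alpha> \<ge> 2\<close> makes the inner sum at most \<open>1 + 1 / b\<close>. The constants satisfy
  $2^\lambda \le b^{\alpha (2d - 1) \lambda / 2} H_{\alpha,d,\lambda,(1)}$, so subadditivity of
  $t \mapsto t^\lambda$ bounds the last sum by the $1/\lambda$-th power of the sum in
  $\tilde A_{\lambda,q}$, which is $O(s^q)$; hence one can take $\beta = q / \lambda$.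
\<close>

section \<open>Sums of the decay coefficients\<close>

lemma nat_digit_leading:
  assumes "0 < \<kappa>" "\<kappa> < b" "k < b ^ n"
  shows "nat_digit b (\<kappa> * b ^ n + k) i = (if i = n then \<kappa> else nat_digit b k i)"
proof -
  have b: "b > 0" using assms by simp
  consider "i < n" | "i = n" | "i > n" by linarith
  then show ?thesis
  proof cases
    case 1
    \<comment> \<open>Writing the gap as \<open>Suc c\<close> leaves a spare factor \<open>b\<close>
      after division by \<open>b ^ i\<close>, so the added part vanishes modulo
      \<open>b\<close>.\<close>
    then obtain c where c: "n = i + Suc c" using less_imp_Suc_add by auto
    have eq: "\<kappa> * b ^ n + k = k + b ^ i * (b * (\<kappa> * b ^ c))"
      by (simp add: c power_add)
    have "(\<kappa> * b ^ n + k) div b ^ i = b * (\<kappa> * b ^ c) + k div b ^ i"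
      unfolding eq using b by (subst div_mult_self2) auto
    then show ?thesis using 1 by (simp add: nat_digit_def)
  next
    case 2
    then show ?thesis using assms by (simp add: nat_digit_def)
  next
    case 3
    have le: "b ^ Suc n \<le> b ^ i" using 3 b by (intro power_increasing) auto
    have "\<kappa> * b ^ n + k < \<kappa> * b ^ n + b ^ n" using assms by simp
    also have "\<dots> = (\<kappa> + 1) * b ^ n" by simp
    also have "\<dots> \<le> b * b ^ n" using assms by (intro mult_right_mono) auto
    finally have "\<kappa> * b ^ n + k < b ^ i" using le by simp
    then show ?thesis using 3 by (simp add: nat_digit_def)
  qed
qed

text \<open>Every nonzero digit of \<open>k\<close> sits at a position at most \<open>n\<close>. The
  new position \<open>Suc n\<close> is therefore the last entry of the sorted list, hence the first
  one taken after reversal, and it uses up one of the \<open>Suc i\<close> slots.\<close>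

lemma mu_alpha_leading:
  assumes "0 < \<kappa>" "\<kappa> < b" "k < b ^ n"
  shows "mu_alpha b (Suc i) (\<kappa> * b ^ n + k) = Suc n + mu_alpha b i k"
proof -
  define A where "A = {a. 1 \<le> a \<and> nat_digit b k (a - 1) \<noteq> 0}"
  have A_le: "a \<le> n" if "a \<in> A" for a
  proof (rule ccontr)
    assume "\<not> a \<le> n"
    then have "b ^ n \<le> b ^ (a - 1)" using assms by (intro power_increasing) auto
    then have "k < b ^ (a - 1)" using assms(3) by linarith
    then have "nat_digit b k (a - 1) = 0" by (simp add: nat_digit_def)
    then show False using that by (simp add: A_def)
  qed
  have fin: "finite A" using A_le by (auto intro: finite_subset[of _ "{..n}"])
  have "{a. 1 \<le> a \<and> nat_digit b (\<kappa> * b ^ n + k) (a - 1) \<noteq> 0} = insert (Suc n) A"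
    unfolding nat_digit_leading[OF assms] using assms(1) by (auto simp: A_def)
  moreover have "sorted_list_of_set (insert (Suc n) A) = sorted_list_of_set A @ [Suc n]"
  proof (rule sorted_distinct_set_unique)
    show "sorted (sorted_list_of_set A @ [Suc n])"
      using fin A_le by (auto simp: sorted_append le_SucI)
    show "distinct (sorted_list_of_set A @ [Suc n])"
      using fin A_le by fastforce
  qed (simp_all add: fin del: sorted_list_of_set_insert_remove)
  ultimately show ?thesis by (simp add: mu_alpha_def A_def)
qed

lemma mu_alpha_mono: "i \<le> j \<Longrightarrow> mu_alpha b i k \<le> mu_alpha b j k"
proof -
  assume "i \<le> j"
  have "take j xs = take i xs @ take (j - i) (drop i xs)" for xs :: "nat list"
    using \<open>i \<le> j\<close> by (metis le_add_diff_inverse take_add)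
  then show ?thesis by (simp add: mu_alpha_def)
qed

lemma r_alpha_nonneg: "0 \<le> r_alpha b \<alpha> k"
  by (simp add: r_alpha_def)

lemma r_alpha_antimono:
  assumes "b > 0" "i \<le> j"
  shows "r_alpha b j k \<le> r_alpha b i k"
  using assms mu_alpha_mono[OF assms(2), of b k]
  by (auto simp: r_alpha_def intro!: divide_left_mono power_increasing)

lemma r_alpha_zero_index: "r_alpha b 0 k = 1"
  by (simp add: r_alpha_def mu_alpha_def)

lemma r_alpha_zero_arg: "r_alpha b \<alpha> 0 = 1"
  by (simp add: r_alpha_def mu_alpha_def nat_digit_def)

section \<open>Closed forms for the sums of \<open>r_alpha\<close> over all
  \<open>k < b ^ n\<close>\<close>

lemma sum_r_alpha_rec:
  assumes "b \<ge> 2"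
  shows "(\<Sum>k<b ^ Suc n. r_alpha b (Suc i) k)
    = (\<Sum>k<b ^ n. r_alpha b (Suc i) k) + (real b - 1) / real b ^ Suc n * (\<Sum>k<b ^ n. r_alpha b i k)"
proof -
  define g where "g = r_alpha b (Suc i)"
  \<comment> \<open>The numbers below \<open>c * b ^ n\<close> are grouped by their quotient on
    division by \<open>b ^ n\<close>; for \<open>c = b\<close> this quotient is the top
    digit.\<close>
  have split: "(\<Sum>k<c * b ^ n. g k) = (\<Sum>\<kappa><c. \<Sum>k<b ^ n. g (\<kappa> * b ^ n + k))" for c
  proof (induction c)
    case (Suc c)
    have "(\<Sum>k<Suc c * b ^ n. g k) = (\<Sum>k<c * b ^ n. g k) + (\<Sum>k = c * b ^ n..<c * b ^ n + b ^ n. g k)"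
      by (simp add: lessThan_atLeast0 sum.atLeastLessThan_concat add.commute)
    also have "(\<Sum>k = c * b ^ n..<c * b ^ n + b ^ n. g k) = (\<Sum>k<b ^ n. g (c * b ^ n + k))"
      using sum.shift_bounds_nat_ivl[of g 0 "c * b ^ n" "b ^ n"]
      by (simp add: lessThan_atLeast0 add.commute)
    finally show ?case using Suc by simp
  qed simp
  \<comment> \<open>A nonzero top digit contributes the factor \<open>1 / b ^ Suc n\<close> and
    lowers the index of \<open>r_alpha\<close> by one. The digit \<open>0\<close> just reproduces
    the sum over \<open>k < b ^ n\<close>.\<close>
  have lead: "(\<Sum>k<b ^ n. g (\<kappa> * b ^ n + k)) = 1 / real b ^ Suc n * (\<Sum>k<b ^ n. r_alpha b i k)"
    if "\<kappa> \<in> {..<b} - {0}" for \<kappa>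
    unfolding sum_distrib_left
    using that by (intro sum.cong) (auto simp: g_def r_alpha_def mu_alpha_leading power_add)
  have "(\<Sum>k<b ^ Suc n. g k) = (\<Sum>\<kappa><b. \<Sum>k<b ^ n. g (\<kappa> * b ^ n + k))"
    using split[of b] by simp
  also have "\<dots> = (\<Sum>k<b ^ n. g k) + (\<Sum>\<kappa>\<in>{..<b} - {0}. \<Sum>k<b ^ n. g (\<kappa> * b ^ n + k))"
    using assms by (subst sum.remove[of _ 0]) auto
  also have "(\<Sum>\<kappa>\<in>{..<b} - {0}. \<Sum>k<b ^ n. g (\<kappa> * b ^ n + k))
      = (real b - 1) / real b ^ Suc n * (\<Sum>k<b ^ n. r_alpha b i k)"
    using assms by (simp add: lead of_nat_diff)
  finally show ?thesis by (simp add: g_def)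
qed

text \<open>For index \<open>0\<close> the sum is \<open>b ^ n\<close>, so each step of the
  recursion adds the constant \<open>(b - 1) / b\<close>. The growth is linear in \<open>n\<close>:
  index \<open>1\<close> gives no summable bound.\<close>

lemma sum_r_alpha_one:
  assumes "b \<ge> 2"
  shows "(\<Sum>k<b ^ n. r_alpha b 1 k) = 1 + real n * (real b - 1) / real b"
proof (induction n)
  case (Suc n)
  have "(\<Sum>k<b ^ n. r_alpha b 0 k) = real b ^ n" by (simp add: r_alpha_zero_index)
  then have "(\<Sum>k<b ^ Suc n. r_alpha b 1 k)
      = 1 + real n * (real b - 1) / real b + (real b - 1) / real b ^ Suc n * real b ^ n"
    using sum_r_alpha_rec[OF assms, of 0 n] Suc by simp
  also have "\<dots> = 1 + real (Suc n) * (real b - 1) / real b"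
    using assms by (simp add: field_simps)
  finally show ?case .
qed (simp add: r_alpha_zero_arg)

text \<open>The linear growth for index \<open>1\<close> is damped by \<open>1 / b ^ Suc n\<close>
  in the recursion. The closed form solves this recursion and increases to the limit
  \<open>2 + 1 / b\<close>, which includes the term \<open>1\<close> of
  \<open>k = 0\<close>.\<close>

lemma sum_r_alpha_two:
  assumes "b \<ge> 2"
  shows "(\<Sum>k<b ^ n. r_alpha b 2 k)
    = 2 + 1 / real b - (1 + 1 / real b + real n * (real b - 1) / real b) / real b ^ n"
proof (induction n)
  case (Suc n)
  have "(\<Sum>k<b ^ Suc n. r_alpha b 2 k)
      = 2 + 1 / real b - (1 + 1 / real b + real n * (real b - 1) / real b) / real b ^ n
        + (real b - 1) / real b ^ Suc n * (1 + real n * (real b - 1) / real b)"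
    using sum_r_alpha_rec[OF assms, of 1 n] Suc sum_r_alpha_one[OF assms, of n]
    by (simp add: numeral_2_eq_2)
  also have "\<dots> = 2 + 1 / real b - (1 + 1 / real b + real (Suc n) * (real b - 1) / real b) / real b ^ Suc n"
    using assms by (simp add: field_simps)
  finally show ?case .
qed (simp add: r_alpha_zero_arg)

lemma sum_r_alpha_le:
  assumes b: "b \<ge> 2" and "\<alpha> \<ge> 2"
  shows "(\<Sum>k = 1..K. r_alpha b \<alpha> k) \<le> 2"
proof -
  \<comment> \<open>This encloses \<open>{1..K}\<close> in a full block \<open>{..<b ^ K}\<close>,
    for which the closed form is available.\<close>
  have K: "K < b ^ K" using b less_exp[of K] power_mono[of 2 b K] by linarith
  have "(\<Sum>k = 1..K. r_alpha b \<alpha> k) \<le> (\<Sum>k = 1..K. r_alpha b 2 k)"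
    using assms by (intro sum_mono r_alpha_antimono) auto
  also have "\<dots> \<le> (\<Sum>k\<in>{..<b ^ K} - {0}. r_alpha b 2 k)"
    using K by (intro sum_mono2) (auto simp: r_alpha_nonneg)
  also have "\<dots> = (\<Sum>k<b ^ K. r_alpha b 2 k) - 1"
    using b by (simp add: sum_diff1 r_alpha_zero_arg)
  also have "\<dots> \<le> 1 + 1 / real b"
    using b by (simp add: sum_r_alpha_two)
  also have "\<dots> \<le> 2" using b by simp
  finally show ?thesis .
qed

text \<open>A finite set of indices fits into a box, and over a box the sum of products factors into
  one-dimensional sums, each at most \<open>2\<close>.\<close>

lemma sum_r_alpha_vec_le:
  assumes "b \<ge> 2" "\<alpha> \<ge> 2" "finite v" "finite F" "F \<subseteq> indices_on v"
  shows "(\<Sum>l\<in>F. r_alpha_vec b \<alpha> v l) \<le> 2 ^ card v"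
proof -
  \<comment> \<open>A crude common bound for all components of all members of \<open>F\<close>, used
    as the side length of the box.\<close>
  define K where "K = (\<Sum>l\<in>F. \<Sum>j\<in>v. l j)"
  have K: "l j \<le> K" if "l \<in> F" "j \<in> v" for l j
  proof -
    have "l j \<le> (\<Sum>j\<in>v. l j)" using that assms by (intro member_le_sum) auto
    also have "\<dots> \<le> K" unfolding K_def using that assms by (intro member_le_sum) auto
    finally show ?thesis .
  qed
  \<comment> \<open>Members of \<open>indices_on v\<close> vanish off \<open>v\<close>, so
    restricting them loses nothing. The restriction is what makes them extensional, as elements of
    \<open>PiE\<close> must be.\<close>
  have inj: "inj_on (\<lambda>l. restrict l v) F"
  proof (rule inj_onI)
    fix l l' assume l: "l \<in> F" "l' \<in> F" and eq: "restrict l v = restrict l' v"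
    show "l = l'"
    proof
      fix j show "l j = l' j"
      proof (cases "j \<in> v")
        case True then show ?thesis using eq by (metis restrict_apply')
      next
        case False
        then have "l j = 0" "l' j = 0" using l assms(5) by (auto simp: indices_on_def)
        then show ?thesis by simp
      qed
    qed
  qed
  have "(\<Sum>l\<in>F. r_alpha_vec b \<alpha> v l) = (\<Sum>h\<in>(\<lambda>l. restrict l v) ` F. \<Prod>j\<in>v. r_alpha b \<alpha> (h j))"
    by (simp add: sum.reindex[OF inj] r_alpha_vec_def)
  also have "\<dots> \<le> (\<Sum>h\<in>PiE v (\<lambda>_. {1..K}). \<Prod>j\<in>v. r_alpha b \<alpha> (h j))"
  proof (rule sum_mono2)
    show "finite (PiE v (\<lambda>_. {1..K}))" using assms by (intro finite_PiE) auto
    show "(\<lambda>l. restrict l v) ` F \<subseteq> PiE v (\<lambda>_. {1..K})"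
      using K assms(5) by (force simp: indices_on_def Suc_le_eq)
  qed (auto intro: prod_nonneg r_alpha_nonneg)
  also have "\<dots> = (\<Prod>j\<in>v. \<Sum>k = 1..K. r_alpha b \<alpha> k)"
    using assms by (subst prod_sum_PiE) auto
  also have "\<dots> \<le> (\<Prod>j\<in>v. 2)"
    using assms by (intro prod_mono) (simp_all add: sum_nonneg r_alpha_nonneg sum_r_alpha_le[simplified])
  finally show ?thesis by simp
qed

section \<open>Point evaluation in the Walsh space\<close>

lemma norm_walsh_vec: "norm (walsh_vec b s l x) = 1"
proof -
  have "norm (exp (2 * complex_of_real pi * \<i> / of_nat b)) = 1"
    by (simp add: norm_exp_eq_Re)
  then show ?thesis by (simp add: walsh_vec_def walsh_def prod_norm[symmetric] norm_power)
qed

lemma walsh_vec_zero: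
  assumes "b \<ge> 2"
  shows "walsh_vec b s (\<lambda>_. 0) x = 1"
  using assms by (simp add: walsh_vec_def walsh_def)

lemma walsh_coeff_bound:
  assumes b: "b \<ge> 2" and \<gamma>: "\<gamma> v \<ge> 0"
    and f: "f \<in> walsh_space b \<alpha> \<gamma> s" "walsh_norm b \<alpha> \<gamma> s f \<le> 1"
    and v: "v \<subseteq> {1..s}" and l: "l \<in> indices_on v"
  shows "norm (walsh_coeff b s f l) \<le> \<gamma> v * r_alpha_vec b \<alpha> v l"
proof (cases "\<gamma> v = 0")
  case True
  \<comment> \<open>The norm ignores sets of weight zero; here the coefficients vanish by the last
    condition in \<open>walsh_space\<close>.\<close>
  then show ?thesis using f v l by (simp add: walsh_space_def)
next
  case False
  then have pos: "\<gamma> v > 0" using \<gamma> by simp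
  have r: "r_alpha_vec b \<alpha> v l > 0"
    using b by (auto simp: r_alpha_vec_def r_alpha_def intro!: prod_pos)
  have "ennreal (1 / \<gamma> v) * ennreal (cmod (walsh_coeff b s f l) / r_alpha_vec b \<alpha> v l)
      \<le> ennreal (1 / \<gamma> v) * (SUP l\<in>indices_on v. ennreal (cmod (walsh_coeff b s f l) / r_alpha_vec b \<alpha> v l))"
    using l by (intro mult_left_mono SUP_upper) auto
  also have "\<dots> \<le> walsh_norm b \<alpha> \<gamma> s f"
    unfolding walsh_norm_def using v False by (intro SUP_upper) auto
  also have "\<dots> \<le> ennreal 1" using f by simp
  finally have "1 / \<gamma> v * (cmod (walsh_coeff b s f l) / r_alpha_vec b \<alpha> v l) \<le> 1"
    using pos r by (subst (asm) ennreal_mult[symmetric]) auto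
  then show ?thesis using pos r by (simp add: field_simps)
qed

text \<open>The integral is the term of index \<open>0\<close> in the Walsh series of
  \<open>f\<close>. The remaining terms are grouped by the support \<open>v\<close> of their index,
  and each group is bounded by \<open>\<gamma> v\<close> times the sum of
  \<open>r_alpha_vec\<close>.\<close>

lemma walsh_space_deviation:
  assumes b: "b \<ge> 2" and \<alpha>: "\<alpha> \<ge> 2" and \<gamma>: "\<And>v. v \<subseteq> {1..s} \<Longrightarrow> \<gamma> v \<ge> 0"
    and f: "f \<in> walsh_space b \<alpha> \<gamma> s" "walsh_norm b \<alpha> \<gamma> s f \<le> 1"
    and x: "x \<in> space (cube s)"
  shows "\<bar>f x - (LINT x|cube s. f x)\<bar> \<le> (\<Sum>v\<in>Pow {1..s} - {{}}. \<gamma> v * 2 ^ card v)"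
proof -
  define L where "L = {l :: nat \<Rightarrow> nat. \<forall>j. j \<notin> {1..s} \<longrightarrow> l j = 0}"
  define h where "h l = walsh_coeff b s f l * walsh_vec b s l x" for l
  define supp where "supp l = {j. 0 < l j}" for l :: "nat \<Rightarrow> nat"
  have "(h has_sum of_real (f x)) L"
    using f(1) x unfolding walsh_space_def L_def h_def by blast
  moreover have "(h has_sum h (\<lambda>_. 0)) {\<lambda>_. 0}"
    using has_sum_finite[of "{\<lambda>_. 0}" h] by simp
  moreover have "h (\<lambda>_. 0) = of_real (LINT x|cube s. f x)"
    by (simp add: h_def walsh_vec_zero[OF b] walsh_coeff_def)
  ultimately have sum: "(h has_sum of_real (f x - (LINT x|cube s. f x))) (L - {\<lambda>_. 0})"
    using has_sum_Diff[where f = h and B = L and A = "{\<lambda>_. 0}"]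
    by (simp add: L_def)
  \<comment> \<open>Bounding every finite partial sum uniformly avoids any separate convergence
    argument for the majorant.\<close>
  have bound: "norm (sum h F) \<le> (\<Sum>v\<in>Pow {1..s} - {{}}. \<gamma> v * 2 ^ card v)"
    if F: "finite F" "F \<subseteq> L - {\<lambda>_. 0}" for F
  proof -
    have supp_F: "supp ` F \<subseteq> Pow {1..s} - {{}}"
    proof -
      have "supp l \<in> Pow {1..s} - {{}}" if "l \<in> L - {\<lambda>_. 0}" for l
        using that unfolding L_def supp_def by (force simp: fun_eq_iff)
      then show ?thesis using F by blast
    qed
    have "norm (sum h F) \<le> (\<Sum>l\<in>F. norm (h l))" by (rule norm_sum)
    also have "\<dots> \<le> (\<Sum>l\<in>F. \<gamma> (supp l) * r_alpha_vec b \<alpha> (supp l) l)"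
    proof (rule sum_mono)
      fix l assume "l \<in> F"
      then have "supp l \<subseteq> {1..s}" "l \<in> indices_on (supp l)"
        using supp_F by (auto simp: supp_def indices_on_def)
      then show "norm (h l) \<le> \<gamma> (supp l) * r_alpha_vec b \<alpha> (supp l) l"
        using walsh_coeff_bound[OF b \<gamma> f] by (simp add: h_def norm_mult norm_walsh_vec)
    qed
    also have "\<dots> = (\<Sum>v\<in>Pow {1..s} - {{}}. \<Sum>l\<in>{l \<in> F. supp l = v}.
        \<gamma> (supp l) * r_alpha_vec b \<alpha> (supp l) l)"
      using F supp_F by (intro sum.group[symmetric]) auto
    also have "\<dots> \<le> (\<Sum>v\<in>Pow {1..s} - {{}}. \<gamma> v * 2 ^ card v)"
    proof (rule sum_mono)
      fix v assume v: "v \<in> Pow {1..s} - {{}}"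
      have "finite v" using v finite_subset[of v "{1..s}"] by simp
      then have "(\<Sum>l\<in>{l \<in> F. supp l = v}. r_alpha_vec b \<alpha> v l) \<le> 2 ^ card v"
        using b \<alpha> F by (intro sum_r_alpha_vec_le) (auto simp: indices_on_def supp_def)
      then show "(\<Sum>l\<in>{l \<in> F. supp l = v}. \<gamma> (supp l) * r_alpha_vec b \<alpha> (supp l) l) \<le> \<gamma> v * 2 ^ card v"
        using \<gamma> v by (simp add: sum_distrib_left[symmetric] mult_left_mono)
    qed
    finally show ?thesis .
  qed
  \<comment> \<open>The uniform bound passes to the limit along the filter of finite
    subsets.\<close>
  have "norm (complex_of_real (f x - (LINT x|cube s. f x)))
      \<le> (\<Sum>v\<in>Pow {1..s} - {{}}. \<gamma> v * 2 ^ card v)"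
    by (rule Lim_norm_ubound[OF finite_subsets_at_top_neq_bot sum[unfolded has_sum_def]
          eventually_finite_subsets_at_top_weakI[OF bound]])
  then show ?thesis by (simp only: norm_of_real)
qed

text \<open>The integration error is the average of the pointwise deviations, each of which has the
  same bound.\<close>

lemma worst_case_error_le:
  assumes b: "b \<ge> 2" and \<alpha>: "\<alpha> \<ge> 2" and \<gamma>: "\<And>v. v \<subseteq> {1..s} \<Longrightarrow> \<gamma> v \<ge> 0"
    and N: "N > 0" and P: "\<And>n. P n \<in> space (cube s)"
  shows "worst_case_error b \<alpha> \<gamma> s N P \<le> ennreal (\<Sum>v\<in>Pow {1..s} - {{}}. \<gamma> v * 2 ^ card v)"
  unfolding worst_case_error_def
proof (intro SUP_least ennreal_leI)
  fix f assume f: "f \<in> {f \<in> walsh_space b \<alpha> \<gamma> s. walsh_norm b \<alpha> \<gamma> s f \<le> 1}"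
  define I where "I = (LINT x|cube s. f x)"
  define B where "B = (\<Sum>v\<in>Pow {1..s} - {{}}. \<gamma> v * 2 ^ card v)"
  have "\<bar>\<Sum>n<N. f (P n) - I\<bar> \<le> (\<Sum>n<N. \<bar>f (P n) - I\<bar>)" by (rule sum_abs)
  also have "\<dots> \<le> (\<Sum>n<N. B)"
    using f P unfolding I_def B_def by (intro sum_mono walsh_space_deviation[OF b \<alpha> \<gamma>]) auto
  finally have "\<bar>\<Sum>n<N. f (P n) - I\<bar> \<le> real N * B" by simp
  moreover have "1 / real N * (\<Sum>n<N. f (P n)) - I = (\<Sum>n<N. f (P n) - I) / real N"
    using N by (simp add: sum_subtractf field_simps)
  ultimately show "\<bar>1 / real N * (\<Sum>n<N. f (P n)) - (LINT x|cube s. f x)\<bar> \<le> B"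
    using N by (simp add: I_def abs_divide divide_le_eq mult.commute)
qed

section \<open>Interlaced points\<close>

lemma real_digit_less: "b > 0 \<Longrightarrow> real_digit b x a < b"
  by (simp add: real_digit_def nat_less_iff)

text \<open>The exponents \<open>i + a * d\<close> with \<open>a < m\<close> run once through
  \<open>1..m * d\<close>, so the value is a terminating expansion with digits at most
  \<open>b - 1\<close>. Termination is what keeps it strictly below \<open>1\<close>.\<close>

lemma interlace_in_unit_interval:
  assumes b: "b \<ge> 2" and zero: "\<And>i a. i \<in> {1..d} \<Longrightarrow> a > m \<Longrightarrow> real_digit b (y i) a = 0"
  shows "interlace b d y \<in> {0..<1}"
proof -
  have b0: "real b > 0" using b by simp
  have "interlace b d y
      = (\<Sum>a<m. \<Sum>i = 1..d. real (real_digit b (y i) (Suc a)) / real b ^ (i + a * d))"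
    unfolding interlace_def using zero by (intro suminf_finite) auto
  moreover have "\<dots> \<ge> 0" by (intro sum_nonneg) auto
  moreover have "(\<Sum>a<m. \<Sum>i = 1..d. real (real_digit b (y i) (Suc a)) / real b ^ (i + a * d))
      \<le> (\<Sum>a<m. \<Sum>i = 1..d. (real b - 1) / real b ^ (i + a * d))"
  proof (intro sum_mono divide_right_mono)
    fix a i
    have "real_digit b (y i) (Suc a) < b" using b by (simp add: real_digit_less)
    then show "real (real_digit b (y i) (Suc a)) \<le> real b - 1" by linarith
  qed auto
  moreover have "(\<Sum>a<m. \<Sum>i = 1..d. (real b - 1) / real b ^ (i + a * d)) = 1 - 1 / real b ^ (m * d)"
  proof -
    \<comment> \<open>Each term is a difference of consecutive powers of \<open>1 / b\<close>; the
      sum telescopes within a group of \<open>d\<close> digits, and then over the groups.\<close>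
    have inner: "(\<Sum>i = 1..d. (real b - 1) / real b ^ (i + c)) = 1 / real b ^ c - 1 / real b ^ (d + c)" for c
    proof (induction d)
      case (Suc d)
      have "(real b - 1) / real b ^ (Suc d + c) = 1 / real b ^ (d + c) - 1 / real b ^ (Suc d + c)"
        using b0 by (simp add: field_simps)
      with Suc show ?case by simp
    qed simp
    show ?thesis by (induction m) (simp_all add: inner[simplified] add.commute)
  qed
  moreover have "1 / real b ^ (m * d) > 0" using b0 by simp
  ultimately show ?thesis unfolding atLeastLessThan_iff by linarith
qed

lemma real_digit_terminating:
  assumes "b > 0" "a > m"
  shows "real_digit b (real_of_int c / real b ^ m) a = 0"
proof -
  \<comment> \<open>Since \<open>a > m\<close>, multiplication by \<open>b ^ a\<close> clears the
    denominator and leaves at least one factor \<open>b\<close>, which makes the digit zero.\<close>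
  obtain k where k: "a = m + Suc k" using assms less_imp_Suc_add by auto
  have "real_of_int c / real b ^ m * real b ^ a = real_of_int (c * int b ^ Suc k)"
    using assms(1) by (simp add: k power_add)
  then have "\<lfloor>real_of_int c / real b ^ m * real b ^ a\<rfloor> = c * int b ^ Suc k"
    by (simp only: floor_of_int)
  then show ?thesis by (simp add: real_digit_def)
qed

lemma v_trunc_denominator:
  "\<exists>c. v_trunc m (L :: 'b::prime_card mod_ring fls) = real_of_int c / real CARD('b) ^ m"
proof
  have eq: "x / real CARD('b) ^ l = x * real CARD('b) ^ (m - l) / real CARD('b) ^ m"
    if "l \<in> {1..m}" for x l
  proof -
    have "real CARD('b) ^ m = real CARD('b) ^ (m - l) * real CARD('b) ^ l"
      using that by (simp add: power_add[symmetric])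
    then show ?thesis by simp
  qed
  show "v_trunc m L
      = real_of_int (\<Sum>l = 1..m. to_int_mod_ring (fls_nth L (int l)) * int CARD('b) ^ (m - l)) / real CARD('b) ^ m"
    unfolding v_trunc_def of_int_sum sum_divide_distrib
    by (intro sum.cong) (simp_all only: eq of_int_mult of_int_power of_int_of_nat_eq)
qed

text \<open>Truncation by \<open>v_trunc\<close> puts every lattice component over the denominator
  \<open>b ^ m\<close>, so its digits beyond position \<open>m\<close> vanish. The extensionality
  demanded by the product space comes from \<open>interlace_vec\<close>.\<close>

lemma interlaced_point_in_cube:
  fixes q :: "nat \<Rightarrow> 'b::prime_card mod_ring poly"
  shows "interlaced_point_set d m s q p n \<in> space (cube s)"
proof -
  have b: "CARD('b) \<ge> 2" using prime_card[where 'a = 'b] by (simp add: prime_ge_2_nat)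
  have "real_digit CARD('b) (lattice_point m q p n j) a = 0" if "a > m" for j a
  proof -
    obtain c where "lattice_point m q p n j = real_of_int c / real CARD('b) ^ m"
      unfolding lattice_point_def using v_trunc_denominator by blast
    then show ?thesis using real_digit_terminating[OF _ that, of "CARD('b)" c] by simp
  qed
  then have "interlace CARD('b) d (\<lambda>i. lattice_point m q p n ((j - 1) * d + i)) \<in> {0..<1}" for j
    using b by (intro interlace_in_unit_interval) auto
  then show ?thesis
    by (auto simp: cube_def space_PiM space_restrict_space interlaced_point_set_def interlace_vec_def)
qed

section \<open>Comparison with the tractability constants\<close>

text \<open>After division by the total \<open>T\<close> the terms lie in \<open>[0, 1]\<close>,
  where \<open>t \<le> t powr lam\<close>, and they add up to \<open>1\<close>. A zero total is
  treated apart because of this division.\<close>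

lemma powr_sum_le:
  fixes x :: "'a \<Rightarrow> real"
  assumes "0 < lam" "lam \<le> 1" "finite A" and nonneg: "\<And>a. a \<in> A \<Longrightarrow> x a \<ge> 0"
  shows "(\<Sum>a\<in>A. x a) \<le> (\<Sum>a\<in>A. x a powr lam) powr (1 / lam)"
proof (cases "(\<Sum>a\<in>A. x a) = 0")
  case False
  define T where "T = (\<Sum>a\<in>A. x a)"
  have T: "T > 0" using False nonneg by (simp add: T_def less_le sum_nonneg)
  have "T powr lam = (\<Sum>a\<in>A. x a / T) * T powr lam"
    using T by (simp add: T_def sum_divide_distrib[symmetric])
  also have "\<dots> \<le> (\<Sum>a\<in>A. (x a / T) powr lam) * T powr lam"
  proof (intro mult_right_mono sum_mono)
    fix a assume a: "a \<in> A"
    have "x a \<le> T" unfolding T_def using a nonneg assms by (intro member_le_sum) auto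
    then show "x a / T \<le> (x a / T) powr lam"
      using T nonneg[OF a] assms powr_mono'[of lam 1 "x a / T"] by simp
  qed auto
  also have "\<dots> = (\<Sum>a\<in>A. x a powr lam)"
    using T nonneg by (simp add: sum_distrib_right powr_divide)
  finally have "(T powr lam) powr (1 / lam) \<le> (\<Sum>a\<in>A. x a powr lam) powr (1 / lam)"
    using assms by (intro powr_mono2) auto
  then show ?thesis using assms T by (simp add: powr_powr T_def)
qed simp

text \<open>Bernoulli's inequality gives \<open>H_const \<ge> d * H_tilde \<ge> 2 * H_tilde\<close>.
  The power of \<open>b\<close> in front outweighs both the small factor and the denominator of
  \<open>H_tilde\<close>.\<close>

lemma H_const_lower_bound:
  assumes b: "b \<ge> 2" and \<alpha>: "\<alpha> \<ge> 2" and d: "d \<ge> 2" and lam: "1 / real (min \<alpha> d) < lam" "lam \<le> 1"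
  shows "2 powr lam \<le> real b powr (real \<alpha> * (2 * real d - 1) * lam / 2) * H_const b \<alpha> d lam"
proof -
  define \<mu> where "\<mu> = real (min \<alpha> d)"
  define D where "D = real b powr (lam * \<mu>) - real b"
  have \<mu>: "\<mu> > 0" using \<alpha> d by (simp add: \<mu>_def)
  have lam_pos: "lam > 0" using lam \<mu> unfolding \<mu>_def by (meson less_trans zero_less_divide_1_iff)
  \<comment> \<open>The lower bound on \<open>lam\<close> is exactly what makes the denominator
    \<open>D\<close> of \<open>H_tilde\<close> positive.\<close>
  have "1 < lam * \<mu>" using lam(1) \<mu> by (simp add: \<mu>_def[symmetric] field_simps)
  then have "real b powr 1 < real b powr (lam * \<mu>)" using b by (intro powr_less_mono) auto
  then have D: "D > 0" using b by (simp add: D_def)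
  have Ht: "H_tilde b \<alpha> d lam = real b powr (- (real \<alpha> * lam / 2)) * ((real b - 1) / D)"
    by (simp add: H_tilde_def D_def \<mu>_def powr_minus divide_simps)
  have "H_tilde b \<alpha> d lam \<ge> 0" using b D by (simp add: Ht)
  then have "2 * H_tilde b \<alpha> d lam \<le> real d * H_tilde b \<alpha> d lam"
    using d by (intro mult_right_mono) auto
  also have "\<dots> \<le> H_const b \<alpha> d lam"
    using Bernoulli_inequality[of "H_tilde b \<alpha> d lam" d] \<open>H_tilde b \<alpha> d lam \<ge> 0\<close>
    by (simp add: H_const_def)
  finally have H: "2 * H_tilde b \<alpha> d lam \<le> H_const b \<alpha> d lam" .
  have "2 powr lam \<le> 2 powr (1::real)" using lam by (intro powr_mono) auto
  also have "\<dots> \<le> 2 * ((real b - 1) * (real b powr (lam * \<mu>) / D))"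
  proof -
    \<comment> \<open>Both factors are at least \<open>1\<close>: \<open>b \<ge> 2\<close>, and
      \<open>D\<close> arises from \<open>b powr (lam * \<mu>)\<close> by subtracting
      \<open>b\<close>.\<close>
    have "1 * 1 \<le> (real b - 1) * (real b powr (lam * \<mu>) / D)"
      using b D by (intro mult_mono) (auto simp: D_def le_divide_eq)
    then show ?thesis by simp
  qed
  also have "\<dots> \<le> 2 * ((real b - 1) * (real b powr (real \<alpha> * (real d - 1) * lam) / D))"
  proof -
    \<comment> \<open>Here \<open>min \<alpha> d \<le> \<alpha> \<le> \<alpha> * (d - 1)\<close>,
      using \<open>d \<ge> 2\<close>. The right side is the exponent left over when
      \<open>\<alpha> / 2\<close> is taken from \<open>\<alpha> * (2 * d - 1) / 2\<close>.\<close>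
    have "\<mu> \<le> real \<alpha> * (real d - 1)"
      using mult_left_mono[of 1 "real d - 1" "real \<alpha>"] d by (simp add: \<mu>_def)
    then have "lam * \<mu> \<le> real \<alpha> * (real d - 1) * lam"
      using lam_pos by (simp add: mult.commute)
    then have "real b powr (lam * \<mu>) \<le> real b powr (real \<alpha> * (real d - 1) * lam)"
      using b by (intro powr_mono) auto
    then show ?thesis using D b by (intro mult_left_mono divide_right_mono) auto
  qed
  also have "\<dots> = real b powr (real \<alpha> * (2 * real d - 1) * lam / 2) * (2 * H_tilde b \<alpha> d lam)"
  proof -
    have "real b powr (real \<alpha> * (2 * real d - 1) * lam / 2) * real b powr (- (real \<alpha> * lam / 2))
        = real b powr (real \<alpha> * (real d - 1) * lam)"
      unfolding powr_add[symmetric] by (rule arg_cong[where f = "(powr) (real b)"]) (simp add: field_simps)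
    then show ?thesis by (simp add: Ht)
  qed
  also have "\<dots> \<le> real b powr (real \<alpha> * (2 * real d - 1) * lam / 2) * H_const b \<alpha> d lam"
    using H by (intro mult_left_mono) auto
  finally show ?thesis .
qed

lemma weighted_sum_le:
  assumes b: "b \<ge> 2" and \<alpha>: "\<alpha> \<ge> 2" and d: "d \<ge> 2" and lam: "1 / real (min \<alpha> d) < lam" "lam \<le> 1"
    and \<gamma>: "\<And>v. v \<subseteq> {1..s} \<Longrightarrow> \<gamma> v \<ge> 0"
  shows "(\<Sum>v\<in>Pow {1..s} - {{}}. \<gamma> v * 2 ^ card v)
    \<le> (\<Sum>v\<in>Pow {1..s} - {{}}. gamma_tilde b \<alpha> d \<gamma> v powr lam * H_const b \<alpha> d lam ^ card v) powr (1 / lam)"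
    (is "_ \<le> ?S powr _")
proof -
  have lam_pos: "lam > 0"
    using lam(1) by (meson le_less_trans of_nat_0_le_iff zero_le_divide_1_iff)
  have le: "(\<gamma> v * 2 ^ card v) powr lam \<le> gamma_tilde b \<alpha> d \<gamma> v powr lam * H_const b \<alpha> d lam ^ card v"
    if "v \<subseteq> {1..s}" for v
  proof -
    \<comment> \<open>The factor that each element of \<open>v\<close> contributes to
      \<open>gamma_tilde\<close> raised to the power \<open>lam\<close>.\<close>
    define c where "c = real b powr (real \<alpha> * (2 * real d - 1) * lam / 2)"
    have "(2 ^ card v) powr lam = (2 powr lam :: real) ^ card v"
      by (simp add: powr_realpow[symmetric] powr_powr powr_power mult.commute)
    also have "\<dots> \<le> (c * H_const b \<alpha> d lam) ^ card v"
      using H_const_lower_bound[OF b \<alpha> d lam] by (intro power_mono) (auto simp: c_def)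
    finally have "(\<gamma> v * 2 ^ card v) powr lam \<le> \<gamma> v powr lam * (c * H_const b \<alpha> d lam) ^ card v"
      using \<gamma>[OF that] by (simp add: powr_mult mult_left_mono)
    moreover have "gamma_tilde b \<alpha> d \<gamma> v powr lam = \<gamma> v powr lam * c ^ card v"
      using \<gamma>[OF that] b by (simp add: gamma_tilde_def c_def powr_mult powr_powr powr_power ac_simps)
    ultimately show ?thesis by (simp add: power_mult_distrib mult.assoc)
  qed
  have "(\<Sum>v\<in>Pow {1..s} - {{}}. \<gamma> v * 2 ^ card v)
      \<le> (\<Sum>v\<in>Pow {1..s} - {{}}. (\<gamma> v * 2 ^ card v) powr lam) powr (1 / lam)"
    using lam_pos lam \<gamma> by (intro powr_sum_le) auto
  also have "\<dots> \<le> ?S powr (1 / lam)"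
    using lam_pos le by (intro powr_mono2 sum_mono sum_nonneg) auto
  finally show ?thesis .
qed

section \<open>Polynomial dependence of the error on the dimension\<close>

theorem corollary5:
  fixes b m \<alpha> d :: nat
    and \<gamma> :: "nat set \<Rightarrow> real"
    and p q\<^sub>0 :: "nat \<Rightarrow> 'b::prime_card mod_ring poly"
  assumes "b = CARD('b)"
    and "m \<ge> 1" and "\<alpha> \<ge> 1" and "d \<ge> 1" and "min \<alpha> d > 1"
    and "\<And>v. finite v \<Longrightarrow> v \<subseteq> {1..} \<Longrightarrow> \<gamma> v \<ge> 0"
    and "\<And>s. s \<ge> 1 \<Longrightarrow> korobov \<alpha> d \<gamma> m s (p s) (q\<^sub>0 s)"
    and "\<exists>lam q. 1 / real (min \<alpha> d) < lam \<and> lam \<le> 1 \<and> q \<ge> 0 \<and> A_tilde b \<alpha> d \<gamma> lam q < \<infinity>"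
  shows "\<exists>C \<beta>. C \<ge> 0 \<and> \<beta> \<ge> 0 \<and>
    (\<forall>s\<ge>1. worst_case_error b \<alpha> \<gamma> s (b ^ m)
        (interlaced_point_set d m s (psi (p s) (q\<^sub>0 s)) (p s))
      \<le> ennreal (C * real s powr \<beta>))"
proof -
  have b: "b \<ge> 2" using prime_card[where 'a = 'b] assms(1) by (simp add: prime_ge_2_nat)
  have \<alpha>: "\<alpha> \<ge> 2" and d: "d \<ge> 2" using assms(5) by auto
  obtain lam q where lam: "1 / real (min \<alpha> d) < lam" "lam \<le> 1" and q: "q \<ge> 0"
    and A: "A_tilde b \<alpha> d \<gamma> lam q < \<infinity>" using assms(8) by blast
  have lam_pos: "lam > 0"
    using lam(1) by (meson le_less_trans of_nat_0_le_iff zero_le_divide_1_iff)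
  have \<gamma>: "\<gamma> v \<ge> 0" if "v \<subseteq> {1..s}" for v s
    using that by (intro assms(6)) (auto intro: finite_subset)
  define S where "S s = (\<Sum>v\<in>Pow {1..s} - {{}}.
    gamma_tilde b \<alpha> d \<gamma> v powr lam * H_const b \<alpha> d lam ^ card v)" for s
  have err: "worst_case_error b \<alpha> \<gamma> s (b ^ m) (interlaced_point_set d m s (psi (p s) (q\<^sub>0 s)) (p s))
      \<le> ennreal (S s powr (1 / lam))" for s
  proof -
    have "worst_case_error b \<alpha> \<gamma> s (b ^ m) (interlaced_point_set d m s (psi (p s) (q\<^sub>0 s)) (p s))
        \<le> ennreal (\<Sum>v\<in>Pow {1..s} - {{}}. \<gamma> v * 2 ^ card v)"
      using b \<alpha> \<gamma> by (intro worst_case_error_le interlaced_point_in_cube) auto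
    also have "\<dots> \<le> ennreal (S s powr (1 / lam))"
      unfolding S_def using \<gamma> by (intro ennreal_leI weighted_sum_le b \<alpha> d lam) auto
    finally show ?thesis .
  qed
  \<comment> \<open>A real number strictly above the limsup bounds the normalised sums from some
    dimension \<open>s\<^sub>0\<close> on.\<close>
  obtain M where M: "A_tilde b \<alpha> d \<gamma> lam q < ereal M"
    using A by (metis ereal_dense2)
  then have "\<forall>\<^sub>F s in sequentially. ereal (1 / real s powr q * S s) < ereal M"
    unfolding A_tilde_def S_def by (rule Limsup_lessD)
  then obtain s\<^sub>0 where s\<^sub>0: "\<And>s. s \<ge> s\<^sub>0 \<Longrightarrow> 1 / real s powr q * S s < M"
    by (auto simp: eventually_sequentially)
  \<comment> \<open>Nonnegativity is read off the lower bound: a negative value would force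
    \<open>2 powr lam \<le> 0\<close>.\<close>
  have H: "H_const b \<alpha> d lam \<ge> 0"
  proof (rule ccontr)
    assume "\<not> H_const b \<alpha> d lam \<ge> 0"
    then have "real b powr (real \<alpha> * (2 * real d - 1) * lam / 2) * H_const b \<alpha> d lam \<le> 0"
      by (intro mult_nonneg_nonpos) auto
    then have "2 powr lam \<le> 0" using H_const_lower_bound[OF b \<alpha> d lam] by linarith
    then show False by simp
  qed
  have S: "S s \<ge> 0" for s
    unfolding S_def using H by (intro sum_nonneg) auto
  \<comment> \<open>The first summand serves the dimensions from \<open>s\<^sub>0\<close> on, the
    second the finitely many smaller ones, where \<open>s powr \<beta> \<ge> 1\<close>. The absolute
    value spares an argument about the sign of \<open>M\<close>.\<close>
  define C where "C = \<bar>M\<bar> powr (1 / lam) + (\<Sum>s<s\<^sub>0. S s powr (1 / lam))"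
  define \<beta> where "\<beta> = q / lam"
  have C: "C \<ge> 0" by (auto simp: C_def intro!: add_nonneg_nonneg sum_nonneg)
  have \<beta>: "\<beta> \<ge> 0" using q lam_pos by (simp add: \<beta>_def)
  have bound: "S s powr (1 / lam) \<le> C * real s powr \<beta>" if s: "s \<ge> 1" for s
  proof (cases "s < s\<^sub>0")
    case True
    have "S s powr (1 / lam) \<le> (\<Sum>s<s\<^sub>0. S s powr (1 / lam))"
      using True by (intro member_le_sum) auto
    also have "\<dots> \<le> C * 1" by (simp add: C_def)
    also have "\<dots> \<le> C * real s powr \<beta>"
      using C s \<beta> by (intro mult_left_mono ge_one_powr_ge_zero) auto
    finally show ?thesis .
  next
    case False
    have "S s < M * real s powr q" using s\<^sub>0[of s] False s by (simp add: field_simps)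
    also have "\<dots> \<le> \<bar>M\<bar> * real s powr q" by (intro mult_right_mono) auto
    finally have "S s powr (1 / lam) \<le> (\<bar>M\<bar> * real s powr q) powr (1 / lam)"
      using S lam_pos by (intro powr_mono2) auto
    also have "\<dots> = \<bar>M\<bar> powr (1 / lam) * real s powr \<beta>"
      by (simp add: powr_mult powr_powr \<beta>_def)
    also have "\<dots> \<le> C * real s powr \<beta>"
      by (intro mult_right_mono) (auto simp: C_def intro: sum_nonneg)
    finally show ?thesis .
  qed
  show ?thesis
    using C \<beta> bound by (intro exI[of _ C] exI[of _ \<beta>]) (auto intro: order_trans[OF err] ennreal_leI)
qed

end
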